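(* Let $x\in(0,1)$ and $\mu,\nu\in\mathbb{C}$. Then the following (mutually inverse) series expansions hold: $$\frac{P_\nu^{-\mu}(x)}{x^\nu}=\sum_{n=0}^\infty(\mu-\nu)_n\,g_n(\nu)\left(\frac{1-x}{1+x}\right)^{\frac n2}P_\nu^{-n-\mu}\!\left(\frac1x\right),$$ $$P_\nu^{-\mu}\!\left(\frac1x\right)=\sum_{n=0}^\infty(\mu-\nu)_n\,g_n(-\nu)\left(\frac{1-x}{1+x}\right)^{\frac n2}\frac{P_\nu^{-n-\mu}(x)}{x^\nu},$$ where $g_n$ are the Mittag-Leffler polynomials.
   Context: $(a)_n=a(a+1)\cdots(a+n-1)$, $(a)_0=1$. The Mittag-Leffler polynomials $g_n(\sigma)$ are defined by $\left(\frac{1+z}{1-z}\right)^\sigma=\sum_{n=0}^\infty g_n(\sigma)z^n$, $|z|<1$. For $\mu,\nu\in\mathbb{C}$ and real $x>-1$, $x\ne1$, $$P_\nu^{-\mu}(x)=\left|\frac{1-x}{1+x}\right|^{\mu/2}\frac{F\left(-\nu,\nu+1;1+\mu;\frac{1-x}{2}\right)}{\Gamma(1+\mu)},$$ where $F(a,b;c;t)$ is the Gauss hypergeometric function (analytically continued to $t\le-1$), and $F(a,b;c;t)/\Gamma(c)$ is understood as the regularized function, entire in $a,b,c$. For $|x|<1$ this is the Ferrers function, for $x>1$ the associated Legendre function of the first kind. *)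

theory Defs
  imports "HOL-Complex_Analysis.Complex_Analysis"
begin

text \<open>
  The coefficients \<open>g\<^sub>n(\<sigma>)\<close> are introduced by their generating function.  For \<open>\<bar>z\<bar> < 1\<close> the number
  \<open>(1 + z) / (1 - z)\<close> lies in the open right half plane, so the principal power is the branch
  that is holomorphic in the unit disc and equal to \<open>1\<close> at \<open>z = 0\<close>.
\<close>

definition mittag_leffler :: "nat \<Rightarrow> complex \<Rightarrow> complex" where
  "mittag_leffler n \<sigma> =
     (THE g. \<forall>z. norm z < 1 \<longrightarrow> (\<lambda>k. g k * z ^ k) sums (((1 + z) / (1 - z)) powr \<sigma>)) n"

text \<open>
  \<open>F(a, b; c; t) / \<Gamma>(c)\<close>.  Since \<open>(c)\<^sub>n \<Gamma>(c) = \<Gamma>(c + n)\<close>, its power series has the coefficients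
  \<open>(a)\<^sub>n (b)\<^sub>n / (\<Gamma>(c + n) n!)\<close>, where \<open>1 / \<Gamma>\<close> is the entire function \<open>rGamma\<close>.  Outside the unit disc
  the value is the one obtained by analytic continuation along the segment from \<open>0\<close>,
  which is the principal branch on the plane cut along \<open>[1, \<infinity>)\<close>.
\<close>

definition is_hypergeo_reg :: "complex \<Rightarrow> complex \<Rightarrow> complex \<Rightarrow> complex set \<Rightarrow> (complex \<Rightarrow> complex) \<Rightarrow> bool"
  where
  "is_hypergeo_reg a b c S f \<longleftrightarrow>
     open S \<and> ball 0 1 \<subseteq> S \<and> (\<forall>z\<in>S. closed_segment 0 z \<subseteq> S) \<and> f holomorphic_on S \<and>
     (\<forall>z\<in>ball 0 1.
        (\<lambda>n. pochhammer a n * pochhammer b n * rGamma (c + of_nat n) / fact n * z ^ n) sums f z)"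

definition hypergeo_reg :: "complex \<Rightarrow> complex \<Rightarrow> complex \<Rightarrow> complex \<Rightarrow> complex" where
  "hypergeo_reg a b c t = (THE w. \<exists>S f. is_hypergeo_reg a b c S f \<and> t \<in> S \<and> f t = w)"

text \<open>
  \<open>legendre_P \<nu> m x\<close> is \<open>P\<^sub>\<nu>\<^sup>m(x)\<close> with upper index \<open>m\<close>, that is \<open>m = -\<mu>\<close> in the formula for \<open>P\<^sub>\<nu>\<^sup>-\<^sup>\<mu>(x)\<close>.
  It is meant for \<open>x > -1\<close>, \<open>x \<noteq> 1\<close>: the Ferrers function for \<open>x < 1\<close>, the associated Legendre
  function of the first kind for \<open>x > 1\<close>.
\<close>

definition legendre_P :: "complex \<Rightarrow> complex \<Rightarrow> real \<Rightarrow> complex" where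
  "legendre_P \<nu> m x =
     complex_of_real \<bar>(1 - x) / (1 + x)\<bar> powr (- m / 2) *
     hypergeo_reg (- \<nu>) (\<nu> + 1) (1 - m) (complex_of_real ((1 - x) / 2))"

text \<open>
  The generating function determines \<open>mittag_leffler\<close>, and the value of \<open>hypergeo_reg\<close> does not depend
  on the choice of the star-shaped domain.
\<close>

lemma mittag_leffler_sums:
  assumes "norm z < 1"
  shows "(\<lambda>n. mittag_leffler n \<sigma> * z ^ n) sums (((1 + z) / (1 - z)) powr \<sigma>)"
proof -
  define f where "f = (\<lambda>z::complex. ((1 + z) / (1 - z)) powr \<sigma>)"
  define P where "P = (\<lambda>g. \<forall>z. norm z < 1 \<longrightarrow> (\<lambda>k. g k * z ^ k) sums f z)"
  have nonneg: "(1 + z) / (1 - z) \<notin> \<real>\<^sub>\<le>\<^sub>0" if "norm z < 1" for z :: complex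
  proof
    assume "(1 + z) / (1 - z) \<in> \<real>\<^sub>\<le>\<^sub>0"
    then obtain r where r: "r \<le> 0" "(1 + z) / (1 - z) = complex_of_real r"
      by (metis nonpos_Reals_cases)
    have "z \<noteq> 1" using that by auto
    then have "1 + z = complex_of_real r * (1 - z)" using r by (simp add: field_simps)
    then have "z * complex_of_real (1 + r) = complex_of_real (r - 1)" by (simp add: algebra_simps)
    then have "norm z * \<bar>1 + r\<bar> = \<bar>r - 1\<bar>" by (metis norm_mult norm_of_real)
    moreover have "norm z * \<bar>1 + r\<bar> \<le> \<bar>1 + r\<bar>"
      using that by (simp add: mult_left_le_one_le)
    ultimately have "\<bar>r - 1\<bar> \<le> \<bar>1 + r\<bar>" by simp
    then have "r = 0" using r(1) by linarith
    then show False using r \<open>z \<noteq> 1\<close> that by (auto simp: add_eq_0_iff)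
  qed
  have hol: "f holomorphic_on ball 0 1"
    unfolding f_def by (rule holomorphic_intros) (use nonneg in \<open>auto intro!: holomorphic_intros\<close>)
  have ex: "P (\<lambda>n. (deriv ^^ n) f 0 / fact n)"
    unfolding P_def using holomorphic_power_series[OF hol] by simp
  have "g = h" if "P g" "P h" for g h
  proof
    fix n
    have "(\<lambda>k. (g k - h k) * z ^ k) sums 0" if "norm z < 1" for z
      using sums_diff[of "\<lambda>k. g k * z ^ k" "f z" "\<lambda>k. h k * z ^ k" "f z"] \<open>P g\<close> \<open>P h\<close> that
      by (simp add: P_def algebra_simps)
    note sm = this
    have "g n - h n = 0"
    proof (rule ccontr)
      assume nz: "g n - h n \<noteq> 0"
      have "g 0 - h 0 = 0" using sm[of 0] by simp
      then have "n > 0" using nz by (cases n) auto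
      have "(\<lambda>k. (g k - h k) * (z - 0) ^ k) sums 0" if "norm (z - 0) < 1" for z
        using sm that by simp
      from powser_0_nonzero[OF zero_less_one this refl nz \<open>n > 0\<close>]
      obtain s where "0 < s" "\<And>z. z \<in> cball (0::complex) s - {0} \<Longrightarrow> (0::complex) \<noteq> 0" by blast
      moreover from this(1) have "complex_of_real s \<in> cball 0 s - {0}" by simp
      ultimately show False by blast
    qed
    then show "g n = h n" by simp
  qed
  then have "P (THE g. P g)" using ex by (metis theI)
  then show ?thesis
    using assms unfolding mittag_leffler_def P_def f_def by blast
qed

lemma hypergeo_reg_eq:
  assumes "is_hypergeo_reg a b c S f" "t \<in> S"
  shows "hypergeo_reg a b c t = f t"
  unfolding hypergeo_reg_def
proof (rule the_equality)
  show "\<exists>S' f'. is_hypergeo_reg a b c S' f' \<and> t \<in> S' \<and> f' t = f t" using assms by blast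
next
  fix w
  assume "\<exists>S' f'. is_hypergeo_reg a b c S' f' \<and> t \<in> S' \<and> f' t = w"
  then obtain S' f' where *: "is_hypergeo_reg a b c S' f'" "t \<in> S'" "f' t = w" by blast
  have star: "closed_segment 0 z \<subseteq> S \<inter> S'" if "z \<in> S \<inter> S'" for z
    using assms * that unfolding is_hypergeo_reg_def by blast
  have "0 \<in> S \<inter> S'" using assms * unfolding is_hypergeo_reg_def by auto
  with star have "starlike (S \<inter> S')" unfolding starlike_def by blast
  then have "connected (S \<inter> S')" by (rule starlike_imp_connected)
  moreover have "open (S \<inter> S')" using assms * unfolding is_hypergeo_reg_def by blast
  moreover have "(\<lambda>z. f' z - f z) holomorphic_on (S \<inter> S')"
    using assms * unfolding is_hypergeo_reg_def
    by (auto intro!: holomorphic_intros intro: holomorphic_on_subset)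
  moreover have "f' z - f z = 0" if "z \<in> ball 0 1" for z
    using assms * that sums_unique2 unfolding is_hypergeo_reg_def by fastforce
  moreover have "(0::complex) islimpt ball 0 1" by (simp add: islimpt_ball)
  moreover have "ball 0 1 \<subseteq> S \<inter> S'" using assms * unfolding is_hypergeo_reg_def by blast
  ultimately have "f' t - f t = 0"
    using analytic_continuation[of "\<lambda>z. f' z - f z" "S \<inter> S'" "ball 0 1" 0 t]
      assms(2) *(2) \<open>0 \<in> S \<inter> S'\<close> by blast
  then show "w = f t" using * by simp
qed

end

theory Submission
  imports Defs
begin

text \<open>
  Put \<open>t = (1 - x) / (1 + x)\<close>, so that \<open>0 < t < 1\<close>. Pfaff's transformation
  \<open>F(a, b; c; z) = (1 - z)\<^sup>-\<^sup>a F(a, c - b; c; z / (z - 1))\<close> brings both Legendre functions to the same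
  shape: with \<open>\<Phi>\<^sub>\<mu>(s) = F(-\<nu>, \<mu> - \<nu>; 1 + \<mu>; s) / \<Gamma>(1 + \<mu>)\<close>, the functions \<open>P\<^sub>\<nu>\<^sup>-\<^sup>\<mu>(x) / x\<^sup>\<nu>\<close> and
  \<open>P\<^sub>\<nu>\<^sup>-\<^sup>\<mu>(1/x)\<close> are \<open>t\<^sup>\<mu>\<^sup>/\<^sup>2 (1 - t)\<^sup>-\<^sup>\<nu>\<close> times \<open>\<Phi>\<^sub>\<mu>(-t)\<close> and \<open>\<Phi>\<^sub>\<mu>(t)\<close> respectively
  (\<open>legendre_P_eq_kernel\<close>, \<open>legendre_P_inverse_eq_kernel\<close>). The first expansion thus becomes
  \<open>\<Phi>\<^sub>\<mu>(-t) = \<Sum>\<^sub>n (\<mu> - \<nu>)\<^sub>n g\<^sub>n(\<nu>) t\<^sup>n \<Phi>\<^sub>\<mu>\<^sub>+\<^sub>n(t)\<close>, and the second one is its mirror image.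

  Expanding \<open>\<Phi>\<^sub>\<mu>\<^sub>+\<^sub>n\<close> in powers of \<open>t\<close> gives an absolutely convergent double series. In the coefficient of
  \<open>t\<^sup>N\<close> the common factor \<open>(\<mu> - \<nu>)\<^sub>N / \<Gamma>(1 + \<mu> + N)\<close> multiplies the convolution of \<open>g\<^sub>n(\<nu>)\<close> with
  \<open>(-\<nu>)\<^sub>k / k!\<close>, the coefficients of \<open>(1 - z)\<^sup>\<nu>\<close>. Since
  \<open>((1 + z) / (1 - z))\<^sup>\<nu> (1 - z)\<^sup>\<nu> = (1 + z)\<^sup>\<nu>\<close>, this convolution is \<open>(-1)\<^sup>N (-\<nu>)\<^sub>N / N!\<close>, and what results
  is the power series of \<open>\<Phi>\<^sub>\<mu>(-t)\<close> (\<open>kernel_expansion\<close>). That the two coefficient families are inverse to each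
  other says that \<open>((1 + z) / (1 - z))\<^sup>\<nu>\<close> and \<open>((1 + z) / (1 - z))\<^sup>-\<^sup>\<nu>\<close> have product \<open>1\<close>.

  For \<open>x \<le> 1/3\<close> the argument \<open>(1 - 1/x) / 2\<close> is at most \<open>-1\<close>, outside the disc of convergence. Pfaff's
  transformation is therefore proved for power series near \<open>0\<close> (\<open>pfaff_near_zero\<close>) and then continued
  analytically to the half plane \<open>Re z < 1/2\<close> (\<open>hypergeo_reg_pfaff\<close>).
\<close>

section \<open>Sequences of subexponential growth\<close>

text \<open>
  The coefficient sequences below grow at most polynomially, but only the weaker bound by every
  geometric sequence with ratio above \<open>1\<close> matters: it says that the power series converges in the
  unit disc, it is stable under products, and it dominates double series by geometric ones.
\<close>

definition subexponential :: "(nat \<Rightarrow> complex) \<Rightarrow> bool" where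
  "subexponential a \<longleftrightarrow> (\<forall>\<rho>>1. \<exists>C\<ge>0. \<forall>n. norm (a n) \<le> C * \<rho> ^ n)"

lemma subexponentialE:
  assumes "subexponential a" "\<rho> > 1"
  obtains C where "C \<ge> 0" "\<And>n. norm (a n) \<le> C * \<rho> ^ n"
  using assms unfolding subexponential_def by blast

text \<open>
  Splitting the ratio as \<open>\<rho> = sqrt \<rho> * sqrt \<rho>\<close> leaves room for one geometric factor from each sequence.
\<close>

lemma subexponential_mult:
  assumes "subexponential a" "subexponential b"
  shows "subexponential (\<lambda>n. a n * b n)"
  unfolding subexponential_def
proof (intro allI impI)
  fix \<rho> :: real assume "\<rho> > 1"
  then have r: "sqrt \<rho> > 1" "sqrt \<rho> * sqrt \<rho> = \<rho>" by auto
  obtain C where C: "C \<ge> 0" "\<And>n. norm (a n) \<le> C * sqrt \<rho> ^ n"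
    using subexponentialE[OF assms(1) r(1)] by blast
  obtain D where D: "D \<ge> 0" "\<And>n. norm (b n) \<le> D * sqrt \<rho> ^ n"
    using subexponentialE[OF assms(2) r(1)] by blast
  have "norm (a n * b n) \<le> (C * D) * \<rho> ^ n" for n
  proof -
    have "norm (a n * b n) \<le> (C * sqrt \<rho> ^ n) * (D * sqrt \<rho> ^ n)"
      unfolding norm_mult using C D \<open>\<rho> > 1\<close> by (intro mult_mono) auto
    also have "\<dots> = (C * D) * (sqrt \<rho> * sqrt \<rho>) ^ n"
      unfolding power_mult_distrib by (simp only: mult_ac)
    finally show ?thesis using r by simp
  qed
  then show "\<exists>C\<ge>0. \<forall>n. norm (a n * b n) \<le> C * \<rho> ^ n" using C D by (meson mult_nonneg_nonneg)
qed

lemma subexponential_if_power_series: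
  assumes "\<And>z. norm z < 1 \<Longrightarrow> summable (\<lambda>n. a n * z ^ n)"
  shows "subexponential a"
  unfolding subexponential_def
proof (intro allI impI)
  fix \<rho> :: real assume r: "\<rho> > 1"
  have "summable (\<lambda>n. a n * of_real (1 / \<rho>) ^ n)"
    by (rule assms) (use r in \<open>simp add: norm_divide\<close>)
  then have "Bseq (\<lambda>n. a n * of_real (1 / \<rho>) ^ n)"
    using summable_LIMSEQ_zero convergentI convergent_imp_Bseq by blast
  then obtain C where C: "C > 0" "\<And>n. norm (a n * of_real (1 / \<rho>) ^ n) \<le> C"
    unfolding Bseq_def by blast
  have "norm (a n) \<le> C * \<rho> ^ n" for n
    using C(2)[of n] r by (simp add: norm_mult norm_power norm_divide field_simps)
  then show "\<exists>C\<ge>0. \<forall>n. norm (a n) \<le> C * \<rho> ^ n" using C(1) by (meson less_imp_le)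
qed

lemma subexponential_summable:
  assumes "subexponential a" "norm z < 1"
  shows "summable (\<lambda>n. a n * z ^ n)"
proof -
  define w where "w = (norm z + 1) / 2"
  have w: "norm z < w" "w < 1" "w > 0" using assms(2) by (auto simp: w_def add_nonneg_pos)
  obtain C where C: "C \<ge> 0" "\<And>n. norm (a n) \<le> C * (1 / w) ^ n"
    using subexponentialE[OF assms(1), of "1 / w"] w by auto
  define q where "q = norm z / w"
  have q: "q \<ge> 0" "q < 1" using w by (auto simp: q_def)
  have "norm (a n * z ^ n) \<le> C * q ^ n" for n
    using mult_right_mono[OF C(2)[of n], of "norm z ^ n"]
    by (simp add: norm_mult norm_power q_def power_divide)
  moreover have "summable (\<lambda>n. C * q ^ n)" using q by (intro summable_mult summable_geometric) auto
  ultimately show ?thesis by (rule summable_comparison_test'[rotated])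
qed

text \<open>
  Writing \<open>c\<^sub>n\<close> for the \<open>n\<close>-th term, the functional equation of \<open>1 / \<Gamma>\<close> gives
  \<open>(b + n) c\<^sub>n\<^sub>+\<^sub>1 = (a + n) c\<^sub>n\<close>, and \<open>\<bar>a + n\<bar> \<le> \<rho> \<bar>b + n\<bar>\<close> for large \<open>n\<close>. Starting from this recurrence
  rather than from quotients covers the values of \<open>b\<close> for which some terms vanish.
\<close>

lemma subexponential_pochhammer_rGamma:
  "subexponential (\<lambda>n. pochhammer a n * rGamma (b + of_nat n))"
  unfolding subexponential_def
proof (intro allI impI)
  fix \<rho> :: real assume r: "\<rho> > 1"
  define c where "c = (\<lambda>n. pochhammer a n * rGamma (b + of_nat n))"
  have rec: "(b + of_nat n) * c (Suc n) = (a + of_nat n) * c n" for n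
    using rGamma_plus1[of "b + of_nat n"] by (simp add: c_def pochhammer_Suc algebra_simps)
  \<comment> \<open>For \<open>n \<ge> N\<close> the first bound gives \<open>norm a + n \<le> \<rho> * (n - norm b)\<close> and the second keeps \<open>b + n\<close>
    away from \<open>0\<close>.\<close>
  obtain N :: nat where N: "real N > (norm a + \<rho> * norm b) / (\<rho> - 1)" "N > norm b"
    by (metis reals_Archimedean2 max_less_iff_conj)
  have step: "norm (c (Suc n)) \<le> \<rho> * norm (c n)" if "n \<ge> N" for n
  proof -
    have n: "real n > (norm a + \<rho> * norm b) / (\<rho> - 1)" "n > norm b" using N that by auto
    have "norm (a + of_nat n) \<le> norm a + n" using norm_triangle_ineq[of a "of_nat n"] by simp
    also have "\<dots> \<le> \<rho> * (n - norm b)" using n r by (simp add: field_simps)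
    also have "\<dots> \<le> \<rho> * norm (b + of_nat n)"
      using norm_diff_ineq[of "of_nat n" b] r by (simp add: add.commute)
    finally have "norm (a + of_nat n) * norm (c n) \<le> \<rho> * norm (b + of_nat n) * norm (c n)"
      by (rule mult_right_mono) auto
    then have "norm (b + of_nat n) * norm (c (Suc n)) \<le> norm (b + of_nat n) * (\<rho> * norm (c n))"
      using arg_cong[OF rec[of n], of norm] by (simp add: norm_mult mult_ac)
    moreover have "norm (b + of_nat n) > 0"
      using norm_diff_ineq[of "of_nat n" b] n by (simp add: add.commute del: zero_less_norm_iff)
    ultimately show ?thesis using mult_le_cancel_left_pos by blast
  qed
  define C where "C = Max (norm ` c ` {..N})"
  have C: "norm (c n) \<le> C" if "n \<le> N" for n unfolding C_def using that by (intro Max_ge) auto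
  have C0: "C \<ge> 0" using C[of 0] norm_ge_zero order_trans by blast
  have "norm (c n) \<le> C * \<rho> ^ n" for n
  proof (induction n)
    case 0
    then show ?case using C[of 0] by simp
  next
    case (Suc n)
    show ?case
    proof (cases "n \<ge> N")
      case True
      then have "norm (c (Suc n)) \<le> \<rho> * norm (c n)" by (rule step)
      also have "\<dots> \<le> \<rho> * (C * \<rho> ^ n)" using Suc r by simp
      finally show ?thesis by (simp add: mult_ac)
    next
      case False
      then have "norm (c (Suc n)) \<le> C" by (intro C) auto
      also have "\<dots> \<le> C * \<rho> ^ Suc n" using C0 r by (simp add: mult_le_cancel_left1 one_le_power del: power_Suc)
      finally show ?thesis .
    qed
  qed
  then show "\<exists>C\<ge>0. \<forall>n. norm (pochhammer a n * rGamma (b + of_nat n)) \<le> C * \<rho> ^ n"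
    using C0 unfolding c_def by blast
qed

lemma rGamma_Suc_eq_inverse_fact: "rGamma (1 + of_nat n :: complex) = 1 / fact n"
  by (simp add: rGamma_inverse_Gamma Gamma_fact inverse_eq_divide)

lemma subexponential_pochhammer_fact: "subexponential (\<lambda>n. pochhammer a n / fact n)"
  using subexponential_pochhammer_rGamma[of a 1] by (simp add: rGamma_Suc_eq_inverse_fact)

section \<open>Rearrangement and convolution\<close>

text \<open>
  A double series dominated by a product of two geometric series converges absolutely, so it may be
  summed by rows or along the diagonals \<open>n + k = N\<close>. This is the only rearrangement principle in
  the development: it carries both Pfaff's transformation and the two expansions.
\<close>

lemma sums_by_diagonals:
  fixes u :: "nat \<Rightarrow> nat \<Rightarrow> complex"
  assumes w: "0 \<le> w" "w < 1" and bound: "\<And>n k. norm (u n k) \<le> C * (w ^ n * w ^ k)"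
    and rows: "\<And>n. (\<lambda>k. u n k) sums R n"
    and diagonals: "(\<lambda>N. \<Sum>n\<le>N. u n (N - n)) sums L"
  shows "R sums L"
proof -
  have geo: "(\<lambda>n. w ^ n) summable_on UNIV"
    using w by (intro norm_summable_imp_summable_on) (simp add: norm_power summable_geometric)
  have "(\<lambda>(n, k). w ^ n * w ^ k) summable_on UNIV \<times> UNIV"
  proof (rule summable_on_SigmaI[where g = "\<lambda>n. w ^ n * (\<Sum>\<^sub>\<infinity>k. w ^ k)"])
    show "((\<lambda>k. case (n, k) of (n, k) \<Rightarrow> w ^ n * w ^ k) has_sum w ^ n * (\<Sum>\<^sub>\<infinity>k. w ^ k)) UNIV" for n
      using has_sum_cmult_right[OF has_sum_infsum[OF geo]] by simp
  qed (use w geo in \<open>auto intro!: summable_on_cmult_left\<close>)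
  then have "(\<lambda>p. C * (w ^ fst p * w ^ snd p)) summable_on UNIV \<times> UNIV"
    by (intro summable_on_cmult_right) (simp add: case_prod_unfold)
  then have abs: "(\<lambda>p. norm (u (fst p) (snd p))) summable_on UNIV \<times> UNIV"
    by (rule Infinite_Sum.abs_summable_on_comparison_test') (use bound in auto)
  then have "(\<lambda>p. u (fst p) (snd p)) summable_on UNIV \<times> UNIV"
    by (rule abs_summable_summable)
  then obtain T where T: "((\<lambda>p. u (fst p) (snd p)) has_sum T) (UNIV \<times> UNIV)"
    by (auto simp: summable_on_def)
  have row: "((\<lambda>k. u n k) has_sum R n) UNIV" for n
  proof (rule norm_summable_imp_has_sum[OF _ rows])
    have "summable (\<lambda>k. (C * w ^ n) * w ^ k)" using w by (intro summable_mult summable_geometric) auto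
    then show "summable (\<lambda>k. norm (u n k))"
      by (rule summable_comparison_test'[where N = 0]) (use bound[of n] in \<open>simp add: mult_ac\<close>)
  qed
  have "(R has_sum T) UNIV" by (rule has_sum_SigmaD[OF T]) (use row in simp)
  moreover have "((\<lambda>N. \<Sum>n\<le>N. u n (N - n)) has_sum T) UNIV"
  proof (rule has_sum_SigmaD)
    have "((\<lambda>(N, n). u n (N - n)) has_sum T) (SIGMA N:UNIV. {..N}) \<longleftrightarrow>
          ((\<lambda>p. u (fst p) (snd p)) has_sum T) (UNIV \<times> UNIV)"
      by (rule has_sum_reindex_bij_witness[where j = "\<lambda>(N, n). (n, N - n)" and i = "\<lambda>(n, k). (n + k, n)"])
        auto
    then show "((\<lambda>(N, n). u n (N - n)) has_sum T) (SIGMA N:UNIV. {..N})" using T by simp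
  qed (auto intro!: has_sum_finite)
  ultimately show ?thesis
    using has_sum_imp_sums sums_unique2[OF diagonals] by metis
qed

text \<open>
  Turns an identity between functions on the unit disc into a convolution identity for their
  coefficients, by uniqueness of the power series of a product.
\<close>

lemma coeff_convolution_of_sums:
  fixes a b e :: "nat \<Rightarrow> complex"
  assumes "\<And>z. norm z < 1 \<Longrightarrow> (\<lambda>n. a n * z ^ n) sums f z"
    and "\<And>z. norm z < 1 \<Longrightarrow> (\<lambda>n. b n * z ^ n) sums g z"
    and "\<And>z. norm z < 1 \<Longrightarrow> (\<lambda>n. e n * z ^ n) sums (f z * g z)"
  shows "(\<Sum>i\<le>n. a i * b (n - i)) = e n"
proof -
  have ev: "h has_fps_expansion Abs_fps s" if "\<And>z. norm z < 1 \<Longrightarrow> (\<lambda>n. s n * z ^ n) sums h z"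
    for h :: "complex \<Rightarrow> complex" and s
  proof (rule has_fps_expansionI)
    have "eventually (\<lambda>z. z \<in> ball 0 1) (nhds (0::complex))"
      by (rule eventually_nhds_in_open) auto
    then show "eventually (\<lambda>u. (\<lambda>n. fps_nth (Abs_fps s) n * u ^ n) sums h u) (nhds 0)"
      by eventually_elim (use that in simp)
  qed
  have "Abs_fps a * Abs_fps b = Abs_fps e"
    by (rule fps_expansion_unique_complex[OF has_fps_expansion_mult[OF ev ev] ev]) (use assms in auto)
  then have "fps_nth (Abs_fps a * Abs_fps b) n = fps_nth (Abs_fps e) n" by simp
  then show ?thesis by (simp add: fps_mult_nth atLeast0AtMost)
qed

section \<open>Convolutions of Mittag-Leffler polynomials\<close>

lemma binomial_series_pochhammer:
  assumes "norm (z::complex) < 1"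
  shows "(\<lambda>n. pochhammer a n / fact n * z ^ n) sums ((1 - z) powr (- a))"
    and "(\<lambda>n. (-1) ^ n * (pochhammer a n / fact n) * z ^ n) sums ((1 + z) powr (- a))"
proof -
  have eq: "(- a gchoose n) * (- z) ^ n = pochhammer a n / fact n * z ^ n" for n
    by (cases "even n") (simp_all add: gbinomial_pochhammer)
  show "(\<lambda>n. pochhammer a n / fact n * z ^ n) sums ((1 - z) powr (- a))"
    using gen_binomial_complex[of "- z" "- a"] assms unfolding eq by simp
  show "(\<lambda>n. (-1) ^ n * (pochhammer a n / fact n) * z ^ n) sums ((1 + z) powr (- a))"
    using gen_binomial_complex[of "z" "- a"] assms by (simp add: gbinomial_pochhammer)
qed

text \<open>
  Both \<open>1 + z\<close> and \<open>1 - z\<close> lie in the right half plane, so their arguments are less than \<open>\<pi>/2\<close> in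
  absolute value and the principal logarithm of the quotient is the difference of the logarithms.
\<close>

lemma quotient_powr_split:
  fixes z \<sigma> :: complex
  assumes "norm z < 1"
  shows "((1 + z) / (1 - z)) powr \<sigma> = (1 + z) powr \<sigma> * (1 - z) powr (- \<sigma>)"
proof -
  have "\<bar>Re z\<bar> < 1" using abs_Re_le_cmod[of z] assms by linarith
  then have re: "Re (1 + z) > 0" "Re (1 - z) > 0" by auto
  then have nz: "1 + z \<noteq> 0" "1 - z \<noteq> 0" by (metis less_irrefl zero_complex.sel(1))+
  have im: "\<bar>Im (Ln (1 + z))\<bar> < pi / 2" "\<bar>Im (Ln (1 - z))\<bar> < pi / 2"
    using Re_Ln_pos_lt nz re by blast+
  have "Ln ((1 + z) / (1 - z)) = Ln (1 + z) - Ln (1 - z)"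
  proof (rule Ln_unique)
    show "exp (Ln (1 + z) - Ln (1 - z)) = (1 + z) / (1 - z)" using nz by (simp add: exp_diff)
  qed (use im in auto)
  then have "\<sigma> * Ln ((1 + z) / (1 - z)) = \<sigma> * Ln (1 + z) + (- \<sigma>) * Ln (1 - z)"
    by (simp only: right_diff_distrib) simp
  then show ?thesis using nz by (simp add: powr_def flip: exp_add)
qed

lemma one_plus_minus_nonzero:
  fixes z :: complex
  assumes "norm z < 1"
  shows "1 + z \<noteq> 0" "1 - z \<noteq> 0"
  using assms by (auto simp: add_eq_0_iff)

lemma mittag_leffler_convolution_inverse:
  "(\<Sum>k\<le>n. mittag_leffler k \<sigma> * mittag_leffler (n - k) (- \<sigma>)) = (if n = 0 then 1 else 0)"
proof (rule coeff_convolution_of_sums[OF mittag_leffler_sums mittag_leffler_sums])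
  fix z :: complex assume z: "norm z < 1"
  have "((1 + z) / (1 - z)) powr \<sigma> * ((1 + z) / (1 - z)) powr (- \<sigma>) = 1"
    using one_plus_minus_nonzero[OF z] by (simp flip: powr_add)
  moreover have "(\<lambda>n. (if n = 0 then 1 else 0) * z ^ n) sums 1"
    using sums_single[of 0 "\<lambda>n. z ^ n"]
    by (simp add: if_distrib[of "\<lambda>x. x * _"] cong: if_cong)
  ultimately show "(\<lambda>n. (if n = 0 then 1 else 0) * z ^ n)
      sums (((1 + z) / (1 - z)) powr \<sigma> * ((1 + z) / (1 - z)) powr (- \<sigma>))" by simp
qed auto

text \<open>
  The coefficient form of \<open>((1 + z) / (1 - z))\<^sup>\<sigma> (1 - z)\<^sup>\<sigma> = (1 + z)\<^sup>\<sigma>\<close>. It is what makes the diagonals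
  of the first expansion collapse; the next lemma, from
  \<open>((1 + z) / (1 - z))\<^sup>-\<^sup>\<sigma> (1 + z)\<^sup>\<sigma> = (1 - z)\<^sup>\<sigma>\<close>, does the same for the second one.
\<close>

lemma mittag_leffler_convolution_binomial:
  "(\<Sum>i\<le>n. mittag_leffler i \<sigma> * (pochhammer (- \<sigma>) (n - i) / fact (n - i)))
     = (-1) ^ n * (pochhammer (- \<sigma>) n / fact n)"
proof (rule coeff_convolution_of_sums[OF mittag_leffler_sums binomial_series_pochhammer(1)])
  fix z :: complex assume z: "norm z < 1"
  have "((1 + z) / (1 - z)) powr \<sigma> * (1 - z) powr \<sigma> = (1 + z) powr \<sigma>"
    using one_plus_minus_nonzero[OF z] by (simp add: quotient_powr_split[OF z] mult.assoc flip: powr_add)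
  then show "(\<lambda>n. (-1) ^ n * (pochhammer (- \<sigma>) n / fact n) * z ^ n)
      sums (((1 + z) / (1 - z)) powr \<sigma> * (1 - z) powr (- (- \<sigma>)))"
    using binomial_series_pochhammer(2)[OF z, of "- \<sigma>"] by simp
qed auto

lemma mittag_leffler_convolution_alternating_binomial:
  "(\<Sum>i\<le>n. mittag_leffler i (- \<sigma>) * ((-1) ^ (n - i) * (pochhammer (- \<sigma>) (n - i) / fact (n - i))))
     = pochhammer (- \<sigma>) n / fact n"
proof (rule coeff_convolution_of_sums[OF mittag_leffler_sums binomial_series_pochhammer(2)])
  fix z :: complex assume z: "norm z < 1"
  have "((1 + z) / (1 - z)) powr (- \<sigma>) * (1 + z) powr \<sigma> = (1 - z) powr \<sigma>"
    using one_plus_minus_nonzero[OF z]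
    by (simp add: quotient_powr_split[OF z] mult.left_commute mult.commute flip: powr_add)
  then show "(\<lambda>n. pochhammer (- \<sigma>) n / fact n * z ^ n)
      sums (((1 + z) / (1 - z)) powr (- \<sigma>) * (1 + z) powr (- (- \<sigma>)))"
    using binomial_series_pochhammer(1)[OF z, of "- \<sigma>"] by simp
qed auto

section \<open>Pfaff's transformation of the regularized hypergeometric function\<close>

definition hypergeo_coeff :: "complex \<Rightarrow> complex \<Rightarrow> complex \<Rightarrow> nat \<Rightarrow> complex" where
  "hypergeo_coeff a b c n = pochhammer a n * pochhammer b n * rGamma (c + of_nat n) / fact n"

definition hypergeo_series :: "complex \<Rightarrow> complex \<Rightarrow> complex \<Rightarrow> complex \<Rightarrow> complex" where
  "hypergeo_series a b c z = (\<Sum>n. hypergeo_coeff a b c n * z ^ n)"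

lemma hypergeo_series_sums:
  assumes "norm z < 1"
  shows "(\<lambda>n. hypergeo_coeff a b c n * z ^ n) sums hypergeo_series a b c z"
proof -
  have "hypergeo_coeff a b c =
      (\<lambda>n. (pochhammer a n / fact n) * (pochhammer b n * rGamma (c + of_nat n)))"
    by (auto simp: hypergeo_coeff_def)
  then have "subexponential (hypergeo_coeff a b c)"
    using subexponential_mult[OF subexponential_pochhammer_fact subexponential_pochhammer_rGamma] by simp
  from subexponential_summable[OF this assms] show ?thesis
    unfolding hypergeo_series_def by (rule summable_sums)
qed

lemma hypergeo_series_holomorphic: "hypergeo_series a b c holomorphic_on ball 0 1"
  by (rule power_series_holomorphic[where a = "hypergeo_coeff a b c"]) (use hypergeo_series_sums in simp)

text \<open>
  Reflecting \<open>(c + k)\<^sub>N\<^sub>-\<^sub>k = (-1)\<^sup>N\<^sup>-\<^sup>k (1 - c - N)\<^sub>N\<^sub>-\<^sub>k\<close> makes the second factor depend on \<open>k\<close> only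
  through its length, so that the binomial theorem for rising factorials applies.
\<close>

lemma chu_vandermonde:
  fixes c d :: complex
  shows "(\<Sum>k\<le>N. (-1) ^ k * of_nat (N choose k) * pochhammer d k * pochhammer (c + of_nat k) (N - k))
           = pochhammer (c - d) N"
proof -
  define e where "e = 1 - c - of_nat N"
  have "pochhammer (c + of_nat k) (N - k) = (-1) ^ (N - k) * pochhammer e (N - k)" if "k \<le> N" for k
    using pochhammer_minus[of "- (c + of_nat k)" "N - k"] that
    by (simp add: e_def of_nat_diff algebra_simps)
  then have "(\<Sum>k\<le>N. (-1) ^ k * of_nat (N choose k) * pochhammer d k * pochhammer (c + of_nat k) (N - k))
      = (\<Sum>k\<le>N. (-1) ^ N * (of_nat (N choose k) * pochhammer d k * pochhammer e (N - k)))"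
    by (intro sum.cong) (auto simp flip: power_add)
  also have "\<dots> = (-1) ^ N * pochhammer (d + e) N"
    by (simp add: pochhammer_binomial_sum sum_distrib_left)
  also have "\<dots> = pochhammer (c - d) N"
    using pochhammer_minus[of "- (c - d)" N] by (simp add: e_def algebra_simps)
  finally show ?thesis .
qed

text \<open>
  Expanding \<open>(z / (z - 1))\<^sup>k (1 - z)\<^sup>-\<^sup>a = (-z)\<^sup>k (1 - z)\<^sup>-\<^sup>a\<^sup>-\<^sup>k\<close> by the binomial series gives a double
  series whose diagonal sums are evaluated by the Chu-Vandermonde identity. The radius \<open>1/8\<close> is a
  convenient one for absolute convergence, not an optimal one; the identity is continued afterwards.
\<close>

lemma pfaff_near_zero:
  assumes z: "norm z < 1 / 8"
  shows "hypergeo_series a b c z = (1 - z) powr (- a) * hypergeo_series a (c - b) c (z / (z - 1))"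
proof -
  define d where "d = c - b"
  define u where "u = (\<lambda>k j. (-1) ^ k * pochhammer d k * rGamma (c + of_nat k) / fact k *
      (pochhammer a (k + j) / fact j) * z ^ (k + j))"
  define R where "R = (\<lambda>k. (1 - z) powr (- a) * (hypergeo_coeff a d c k * (z / (z - 1)) ^ k))"
  have nz: "1 - z \<noteq> 0" using z by auto
  obtain C where C: "C \<ge> 0" "\<And>k. norm (pochhammer d k * rGamma (c + of_nat k)) \<le> C * 2 ^ k"
    using subexponentialE[OF subexponential_pochhammer_rGamma[of d c], of 2] by auto
  obtain D where D: "D \<ge> 0" "\<And>N. norm (pochhammer a N / fact N) \<le> D * 2 ^ N"
    using subexponentialE[OF subexponential_pochhammer_fact[of a], of 2] by auto
  have "R sums hypergeo_series a b c z"
  proof (rule sums_by_diagonals)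
    \<comment> \<open>Up to constants, each of the two coefficient sequences and the binomial coefficient contributes
      at most a factor \<open>2\<close> per index, hence the ratio \<open>8 * norm z\<close>.\<close>
    show "0 \<le> 8 * norm z" "8 * norm z < 1" using z by auto
  next
    fix k j
    have "u k j = (-1) ^ k * (pochhammer d k * rGamma (c + of_nat k)) *
        (pochhammer a (k + j) / fact (k + j)) * of_nat ((k + j) choose k) * z ^ (k + j)"
      by (simp add: u_def binomial_fact)
    then have "norm (u k j) = norm (pochhammer d k * rGamma (c + of_nat k)) *
        norm (pochhammer a (k + j) / fact (k + j)) * real ((k + j) choose k) * norm z ^ (k + j)"
      by (simp add: norm_mult norm_power norm_divide)
    also have "\<dots> \<le> (C * 2 ^ (k + j)) * (D * 2 ^ (k + j)) * 2 ^ (k + j) * norm z ^ (k + j)"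
    proof (intro mult_mono order_refl)
      have "C * 2 ^ k \<le> C * 2 ^ (k + j)" using C(1) by (intro mult_left_mono power_increasing) auto
      then show "norm (pochhammer d k * rGamma (c + of_nat k)) \<le> C * 2 ^ (k + j)"
        using C(2)[of k] by linarith
      have "(k + j) choose k \<le> 2 ^ (k + j)"
        using member_le_sum[of k "{..k + j}" "\<lambda>i. (k + j) choose i"] by (simp add: choose_row_sum)
      then show "real ((k + j) choose k) \<le> 2 ^ (k + j)"
        by (metis of_nat_le_iff of_nat_numeral of_nat_power)
    qed (use C D in auto)
    also have "\<dots> = C * D * ((2 * 2 * 2 * norm z) ^ (k + j))"
      unfolding power_mult_distrib by (simp only: mult_ac)
    also have "\<dots> = C * D * ((8 * norm z) ^ k * (8 * norm z) ^ j)" by (simp add: power_add)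
    finally show "norm (u k j) \<le> C * D * ((8 * norm z) ^ k * (8 * norm z) ^ j)" .
  next
    fix k
    have "(\<lambda>j. ((-1) ^ k * pochhammer d k * rGamma (c + of_nat k) / fact k * pochhammer a k * z ^ k) *
          (pochhammer (a + of_nat k) j / fact j * z ^ j)) sums
        (((-1) ^ k * pochhammer d k * rGamma (c + of_nat k) / fact k * pochhammer a k * z ^ k) *
          (1 - z) powr (- (a + of_nat k)))"
      using z by (intro sums_mult binomial_series_pochhammer(1)) auto
    moreover have "((-1) ^ k * pochhammer d k * rGamma (c + of_nat k) / fact k * pochhammer a k * z ^ k) *
          (pochhammer (a + of_nat k) j / fact j * z ^ j) = u k j" for j
      by (simp add: u_def pochhammer_product' power_add)
    moreover have "((-1) ^ k * pochhammer d k * rGamma (c + of_nat k) / fact k * pochhammer a k * z ^ k) *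
          (1 - z) powr (- (a + of_nat k)) = R k"
    proof -
      have "(1 - z) powr (- (a + of_nat k)) = (1 - z) powr (- a) / (1 - z) ^ k"
        using nz by (simp add: powr_diff powr_nat')
      moreover have "(z / (z - 1)) ^ k = (-1) ^ k * z ^ k / (1 - z) ^ k"
      proof -
        have "z / (z - 1) = (- 1) * z / (1 - z)"
          by (metis minus_diff_eq minus_divide_divide mult_minus1)
        then show ?thesis by (simp only: power_divide power_mult_distrib)
      qed
      ultimately show ?thesis by (simp add: R_def hypergeo_coeff_def mult_ac)
    qed
    ultimately show "(\<lambda>j. u k j) sums R k" by simp
  next
    have "(\<Sum>k\<le>N. u k (N - k)) = hypergeo_coeff a b c N * z ^ N" for N
    proof -
      have "u k (N - k) = pochhammer a N * rGamma (c + of_nat N) / fact N * z ^ N *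
          ((-1) ^ k * of_nat (N choose k) * pochhammer d k * pochhammer (c + of_nat k) (N - k))"
        if "k \<le> N" for k
      proof -
        have "rGamma (c + of_nat k) = pochhammer (c + of_nat k) (N - k) * rGamma (c + of_nat N)"
          using pochhammer_rGamma[of "c + of_nat k" "N - k"] that by (simp add: of_nat_diff)
        then show ?thesis using that by (simp add: u_def binomial_fact)
      qed
      then have "(\<Sum>k\<le>N. u k (N - k)) = pochhammer a N * rGamma (c + of_nat N) / fact N * z ^ N *
          (\<Sum>k\<le>N. (-1) ^ k * of_nat (N choose k) * pochhammer d k * pochhammer (c + of_nat k) (N - k))"
        by (simp add: sum_distrib_left)
      then show ?thesis unfolding chu_vandermonde by (simp add: hypergeo_coeff_def d_def)
    qed
    then show "(\<lambda>N. \<Sum>k\<le>N. u k (N - k)) sums hypergeo_series a b c z"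
      using hypergeo_series_sums[of z a b c] z by simp
  qed
  moreover have "R sums ((1 - z) powr (- a) * hypergeo_series a d c (z / (z - 1)))"
  proof -
    have "1 - norm z \<le> norm (z - 1)" using norm_triangle_ineq2[of 1 z] by (simp add: norm_minus_commute)
    then have "norm z < norm (z - 1)" using z by linarith
    then have "norm (z / (z - 1)) < 1" using nz by (simp add: norm_divide)
    then show ?thesis unfolding R_def by (intro sums_mult hypergeo_series_sums)
  qed
  ultimately show ?thesis unfolding d_def using sums_unique2 by blast
qed

text \<open>
  A point with real part below \<open>1/2\<close> is closer to \<open>0\<close> than to \<open>1\<close>, and the principal power of
  \<open>1 - z\<close> is holomorphic there.
\<close>

lemma pfaff_argument_in_disc:
  assumes "Re z < 1 / 2"
  shows "norm (z / (z - 1)) < 1" "1 - z \<notin> \<real>\<^sub>\<le>\<^sub>0"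
proof -
  have "norm z ^ 2 < norm (z - 1) ^ 2"
    unfolding cmod_power2 using assms by (simp add: power2_eq_square algebra_simps)
  then have "norm z < norm (z - 1)" by (rule power2_less_imp_less) simp
  then show "norm (z / (z - 1)) < 1" by (simp add: norm_divide divide_less_eq)
  show "1 - z \<notin> \<real>\<^sub>\<le>\<^sub>0" using assms by (auto simp: complex_nonpos_Reals_iff)
qed

text \<open>
  Pfaff's right-hand side is holomorphic on the whole half plane \<open>Re z < 1/2\<close> and agrees with the
  power series near \<open>0\<close>, hence on the convex intersection of the half plane with the unit disc. The
  two therefore glue to a function on the union of disc and half plane. This union is star-shaped
  about \<open>0\<close>, so the glued function gives the value of \<open>hypergeo_reg\<close>, also to the left of the disc.
\<close>

lemma hypergeo_reg_pfaff:
  assumes t: "Re t < 1 / 2"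
  shows "hypergeo_reg a b c t = (1 - t) powr (- a) * hypergeo_series a (c - b) c (t / (t - 1))"
proof -
  define H where "H = {z. Re z < 1 / 2}"
  define F where "F = (\<lambda>z. (1 - z) powr (- a) * hypergeo_series a (c - b) c (z / (z - 1)))"
  have H: "open H" "convex H" unfolding H_def
    by (rule open_halfspace_Re_lt convex_halfspace_Re_lt)+
  have "(hypergeo_series a (c - b) c \<circ> (\<lambda>z. z / (z - 1))) holomorphic_on H"
  proof (rule holomorphic_on_compose_gen[OF _ hypergeo_series_holomorphic])
    show "(\<lambda>z. z / (z - 1)) holomorphic_on H"
      by (intro holomorphic_intros) (auto simp: H_def)
    show "(\<lambda>z. z / (z - 1)) ` H \<subseteq> ball 0 1"
      using pfaff_argument_in_disc(1) by (auto simp: H_def)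
  qed
  then have holF: "F holomorphic_on H"
    unfolding F_def o_def using pfaff_argument_in_disc(2) by (intro holomorphic_intros) (auto simp: H_def)
  have agree: "hypergeo_series a b c z = F z" if "z \<in> ball 0 1" "z \<in> H" for z
  proof -
    have "F z - hypergeo_series a b c z = 0"
    proof (rule analytic_continuation[of "\<lambda>z. F z - hypergeo_series a b c z" "ball 0 1 \<inter> H" "ball 0 (1 / 8)" 0])
      show "(\<lambda>z. F z - hypergeo_series a b c z) holomorphic_on ball 0 1 \<inter> H"
        using holF hypergeo_series_holomorphic by (auto intro!: holomorphic_intros intro: holomorphic_on_subset)
      show "open (ball 0 1 \<inter> H)" using H by auto
      show "connected (ball 0 1 \<inter> H)" using H by (intro convex_connected convex_Int) auto
      show "ball 0 (1 / 8) \<subseteq> ball 0 1 \<inter> H"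
      proof
        fix w :: complex assume "w \<in> ball 0 (1 / 8)"
        then have "norm w < 1 / 8" by simp
        moreover have "Re w \<le> norm w" by (rule complex_Re_le_cmod)
        ultimately show "w \<in> ball 0 1 \<inter> H" by (simp add: H_def)
      qed
      show "(0::complex) islimpt ball 0 (1 / 8)" by (simp add: islimpt_ball)
      show "F w - hypergeo_series a b c w = 0" if "w \<in> ball 0 (1 / 8)" for w
        using pfaff_near_zero[of w a b c] that by (simp add: F_def)
    qed (use that in \<open>auto simp: H_def\<close>)
    then show ?thesis by simp
  qed
  define G where "G = (\<lambda>z. if z \<in> ball 0 1 then hypergeo_series a b c z else F z)"
  have "is_hypergeo_reg a b c (ball 0 1 \<union> H) G"
    unfolding is_hypergeo_reg_def
  proof (intro conjI ballI)
    show "G holomorphic_on ball 0 1 \<union> H"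
      unfolding G_def using H hypergeo_series_holomorphic holF agree by (intro holomorphic_on_If_Un) auto
    show "closed_segment 0 z \<subseteq> ball 0 1 \<union> H" if "z \<in> ball 0 1 \<union> H" for z
    proof -
      have "0 \<in> H" by (simp add: H_def)
      then show ?thesis using that H(2) convex_ball[of "0::complex" 1]
        by (metis Un_iff closed_segment_subset centre_in_ball zero_less_one le_supI1 le_supI2)
    qed
    show "(\<lambda>n. pochhammer a n * pochhammer b n * rGamma (c + of_nat n) / fact n * z ^ n) sums G z"
      if "z \<in> ball 0 1" for z
      using hypergeo_series_sums[of z a b c] that by (simp add: G_def hypergeo_coeff_def)
  qed (use H in auto)
  then have "hypergeo_reg a b c t = G t" using t by (intro hypergeo_reg_eq) (auto simp: H_def)
  also have "\<dots> = F t" using agree[of t] t by (simp add: G_def H_def)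
  finally show ?thesis by (simp add: F_def)
qed

section \<open>Legendre functions at reciprocal arguments\<close>

text \<open>
  The part of a Legendre function that remains after Pfaff's transformation once the elementary
  prefactors are removed. Its power series has the coefficients
  \<open>(-\<nu>)\<^sub>k (\<mu> - \<nu>)\<^sub>k / (\<Gamma>(1 + \<mu> + k) k!)\<close>; raising \<open>\<mu>\<close> by \<open>n\<close> shifts the index in the two
  factors that contain \<open>\<mu>\<close>.
\<close>

definition legendre_kernel :: "complex \<Rightarrow> complex \<Rightarrow> complex \<Rightarrow> complex" where
  "legendre_kernel \<nu> \<mu> s = hypergeo_series (- \<nu>) (\<mu> - \<nu>) (1 + \<mu>) s"

text \<open>
  With \<open>x = (1 - t) / (1 + t)\<close>, the hypergeometric argument \<open>(1 - x) / 2\<close> is \<open>t / (1 + t)\<close>, which Pfaff's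
  map \<open>z \<mapsto> z / (z - 1)\<close> sends to \<open>-t\<close>; replacing \<open>x\<close> by \<open>1 / x\<close> replaces \<open>t\<close> by \<open>-t\<close>. Dividing the Ferrers
  function by \<open>x\<^sup>\<nu>\<close> makes the two prefactors equal.
\<close>

lemma
  fixes x :: real and \<mu> \<nu> :: complex
  assumes x: "0 < x" "x < 1"
  defines "t \<equiv> (1 - x) / (1 + x)"
  shows legendre_P_eq_kernel:
      "legendre_P \<nu> (- \<mu>) x / complex_of_real x powr \<nu> =
         of_real t powr (\<mu> / 2) * of_real (1 - t) powr (- \<nu>) * legendre_kernel \<nu> \<mu> (- of_real t)"
    and legendre_P_inverse_eq_kernel:
      "legendre_P \<nu> (- \<mu>) (1 / x) =
         of_real t powr (\<mu> / 2) * of_real (1 - t) powr (- \<nu>) * legendre_kernel \<nu> \<mu> (of_real t)"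
proof -
  have t: "0 < t" "t < 1" and x_eq: "x = (1 - t) * (1 / (1 + t))"
    using x by (auto simp: t_def field_simps)
  have split: "of_real x powr \<nu> = of_real (1 - t) powr \<nu> * of_real (1 / (1 + t)) powr \<nu>"
    unfolding x_eq of_real_mult using t by (intro powr_times_real) auto
  have nz: "of_real (1 / (1 + t)) powr \<nu> \<noteq> 0" using t by (simp del: of_real_divide of_real_add)
  have cancel: "p * (r * k) / (q * r) = p * inverse q * k" if "r \<noteq> 0" for p q r k :: complex
    using that by (simp add: divide_inverse)
  have arg: "1 - (1 - x) / 2 = 1 / (1 + t)" "(1 - x) / 2 / ((1 - x) / 2 - 1) = - t"
    using x by (simp_all add: t_def field_simps)
  have "hypergeo_reg (- \<nu>) (\<nu> + 1) (1 + \<mu>) (of_real ((1 - x) / 2)) =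
      (1 - of_real ((1 - x) / 2)) powr \<nu> *
      hypergeo_series (- \<nu>) (1 + \<mu> - (\<nu> + 1)) (1 + \<mu>) (of_real ((1 - x) / 2) / (of_real ((1 - x) / 2) - 1))"
    using hypergeo_reg_pfaff[of "of_real ((1 - x) / 2)" "- \<nu>" "\<nu> + 1" "1 + \<mu>"] x by simp
  also have "1 - complex_of_real ((1 - x) / 2) = of_real (1 / (1 + t))"
    using arg(1) by (metis of_real_1 of_real_diff)
  also have "complex_of_real ((1 - x) / 2) / (of_real ((1 - x) / 2) - 1) = - of_real t"
    using arg(2) by (metis of_real_1 of_real_diff of_real_divide of_real_minus)
  finally have h: "hypergeo_reg (- \<nu>) (\<nu> + 1) (1 + \<mu>) (of_real ((1 - x) / 2)) =
      of_real (1 / (1 + t)) powr \<nu> * legendre_kernel \<nu> \<mu> (- of_real t)"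
    by (simp add: legendre_kernel_def)
  have "\<bar>(1 - x) / (1 + x)\<bar> = t" using t(1) unfolding t_def by (rule abs_of_pos)
  then have "legendre_P \<nu> (- \<mu>) x =
      of_real t powr (\<mu> / 2) * (of_real (1 / (1 + t)) powr \<nu> * legendre_kernel \<nu> \<mu> (- of_real t))"
    unfolding legendre_P_def using h by simp
  then show "legendre_P \<nu> (- \<mu>) x / complex_of_real x powr \<nu> =
         of_real t powr (\<mu> / 2) * of_real (1 - t) powr (- \<nu>) * legendre_kernel \<nu> \<mu> (- of_real t)"
    unfolding split powr_minus using nz cancel by (simp only:)
  have arg': "1 - (1 - 1 / x) / 2 = 1 / (1 - t)" "(1 - 1 / x) / 2 / ((1 - 1 / x) / 2 - 1) = t"
  proof -
    have "1 / x = (1 + t) / (1 - t)" using t by (simp add: x_eq)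
    then have s: "(1 - 1 / x) / 2 = - t / (1 - t)" "(1 - 1 / x) / 2 - 1 = - 1 / (1 - t)"
      using t by (simp_all add: field_simps)
    show "1 - (1 - 1 / x) / 2 = 1 / (1 - t)" using s(2) by simp
    show "(1 - 1 / x) / 2 / ((1 - 1 / x) / 2 - 1) = t" unfolding s(2) unfolding s(1) using t by simp
  qed
  have "hypergeo_reg (- \<nu>) (\<nu> + 1) (1 + \<mu>) (of_real ((1 - 1 / x) / 2)) =
      (1 - of_real ((1 - 1 / x) / 2)) powr \<nu> *
      hypergeo_series (- \<nu>) (1 + \<mu> - (\<nu> + 1)) (1 + \<mu>)
        (of_real ((1 - 1 / x) / 2) / (of_real ((1 - 1 / x) / 2) - 1))"
    using hypergeo_reg_pfaff[of "of_real ((1 - 1 / x) / 2)" "- \<nu>" "\<nu> + 1" "1 + \<mu>"] x by simp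
  also have "1 - complex_of_real ((1 - 1 / x) / 2) = of_real (1 / (1 - t))"
    using arg'(1) by (metis of_real_1 of_real_diff)
  also have "complex_of_real ((1 - 1 / x) / 2) / (of_real ((1 - 1 / x) / 2) - 1) = of_real t"
    using arg'(2) by (metis of_real_1 of_real_diff of_real_divide)
  finally have h': "hypergeo_reg (- \<nu>) (\<nu> + 1) (1 + \<mu>) (of_real ((1 - 1 / x) / 2)) =
      of_real (1 / (1 - t)) powr \<nu> * legendre_kernel \<nu> \<mu> (of_real t)"
    by (simp add: legendre_kernel_def)
  have "1 - 1 / x = - (1 - x) / x" "1 + 1 / x = (1 + x) / x" using x by (simp_all add: field_simps)
  then have "(1 - 1 / x) / (1 + 1 / x) = (x - 1) / (1 + x)" using x by simp
  also have "\<dots> = - t" using x by (simp add: t_def field_simps)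
  finally have "\<bar>(1 - 1 / x) / (1 + 1 / x)\<bar> = t" using t by simp
  moreover have "complex_of_real (1 / (1 - t)) powr \<nu> = of_real (1 - t) powr (- \<nu>)"
  proof -
    have "complex_of_real (1 / (1 - t)) powr \<nu> * of_real (1 - t) powr \<nu>
        = (of_real (1 / (1 - t)) * of_real (1 - t)) powr \<nu>"
      using t by (intro powr_times_real[symmetric]) auto
    also have "complex_of_real (1 / (1 - t)) * of_real (1 - t) = 1"
      unfolding of_real_mult[symmetric] using t by simp
    finally have "complex_of_real (1 / (1 - t)) powr \<nu> * of_real (1 - t) powr \<nu> = 1" by simp
    then show ?thesis unfolding powr_minus by (metis inverse_unique mult.commute)
  qed
  ultimately show "legendre_P \<nu> (- \<mu>) (1 / x) =
         of_real t powr (\<mu> / 2) * of_real (1 - t) powr (- \<nu>) * legendre_kernel \<nu> \<mu> (of_real t)"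
    unfolding legendre_P_def using h' by simp
qed

text \<open>
  The product \<open>(\<mu> - \<nu>)\<^sub>n (\<mu> + n - \<nu>)\<^sub>k = (\<mu> - \<nu>)\<^sub>n\<^sub>+\<^sub>k\<close> and the Gamma factor depend on \<open>n + k\<close> only, so
  along a diagonal they can be pulled out and leave the convolution of \<open>A\<close> with a binomial series.
  Taking \<open>(\<epsilon>, \<delta>)\<close> to be \<open>(1, -1)\<close> or \<open>(-1, 1)\<close> yields the two expansions.
\<close>

lemma kernel_expansion:
  assumes "norm t < 1" and eps: "norm \<epsilon> = 1" "norm \<delta> = 1"
    and A: "subexponential A"
    and conv: "\<And>N. (\<Sum>n\<le>N. A n * (\<epsilon> ^ (N - n) * (pochhammer (- \<nu>) (N - n) / fact (N - n))))
                 = \<delta> ^ N * (pochhammer (- \<nu>) N / fact N)"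
  shows "(\<lambda>n. pochhammer (\<mu> - \<nu>) n * A n * t ^ n * legendre_kernel \<nu> (\<mu> + of_nat n) (\<epsilon> * t))
           sums legendre_kernel \<nu> \<mu> (\<delta> * t)"
proof -
  define c where "c = (\<lambda>n. pochhammer (\<mu> - \<nu>) n * rGamma (1 + \<mu> + of_nat n))"
  define B where "B = (\<lambda>k. \<epsilon> ^ k * (pochhammer (- \<nu>) k / fact k))"
  define u where "u = (\<lambda>n k. A n * B k * c (n + k) * t ^ (n + k))"
  have B: "subexponential B"
    using subexponential_pochhammer_fact[of "- \<nu>"] eps
    by (simp add: B_def subexponential_def norm_mult norm_power norm_divide)
  have c: "subexponential c" unfolding c_def by (rule subexponential_pochhammer_rGamma)
  \<comment> \<open>Each term of the double series is at most a constant times \<open>(r\<^sup>2 * norm t) ^ (n + k)\<close> for every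
    \<open>r > 1\<close>; this choice of \<open>r\<close> makes the ratio less than \<open>1\<close>.\<close>
  define r where "r = sqrt (2 / (1 + norm t))"
  have r: "r > 1" "r\<^sup>2 * norm t < 1"
  proof -
    have pos: "1 + norm t > 0" by (simp add: add_pos_nonneg)
    then show "r > 1" using assms(1) by (simp add: r_def)
    have "r\<^sup>2 = 2 / (1 + norm t)" using pos by (simp add: r_def)
    show "r\<^sup>2 * norm t < 1" unfolding \<open>r\<^sup>2 = 2 / (1 + norm t)\<close> using assms(1) pos by (simp add: divide_simps)
  qed
  obtain CA where CA: "CA \<ge> 0" "\<And>n. norm (A n) \<le> CA * r ^ n" using subexponentialE[OF A r(1)] by blast
  obtain CB where CB: "CB \<ge> 0" "\<And>n. norm (B n) \<le> CB * r ^ n" using subexponentialE[OF B r(1)] by blast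
  obtain Cc where Cc: "Cc \<ge> 0" "\<And>n. norm (c n) \<le> Cc * r ^ n" using subexponentialE[OF c r(1)] by blast
  show ?thesis
  proof (rule sums_by_diagonals)
    show "0 \<le> r\<^sup>2 * norm t" "r\<^sup>2 * norm t < 1" using r by auto
  next
    fix n k
    have "norm (u n k) \<le> (CA * r ^ n) * (CB * r ^ k) * (Cc * r ^ (n + k)) * norm t ^ (n + k)"
      unfolding u_def norm_mult norm_power using CA CB Cc r(1) by (intro mult_mono) auto
    also have "\<dots> = CA * CB * Cc * (r * r * norm t) ^ (n + k)"
      unfolding power_mult_distrib by (simp add: power_add mult_ac)
    finally show "norm (u n k) \<le> CA * CB * Cc * ((r\<^sup>2 * norm t) ^ n * (r\<^sup>2 * norm t) ^ k)"
      by (simp add: power_add power2_eq_square)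
  next
    fix n
    have "norm (\<epsilon> * t) < 1" using assms by (simp add: norm_mult)
    from sums_mult[OF hypergeo_series_sums[OF this]]
    have "(\<lambda>k. (pochhammer (\<mu> - \<nu>) n * A n * t ^ n) *
          (hypergeo_coeff (- \<nu>) (\<mu> + of_nat n - \<nu>) (1 + (\<mu> + of_nat n)) k * (\<epsilon> * t) ^ k)) sums
        (pochhammer (\<mu> - \<nu>) n * A n * t ^ n * legendre_kernel \<nu> (\<mu> + of_nat n) (\<epsilon> * t))"
      unfolding legendre_kernel_def .
    moreover have "(pochhammer (\<mu> - \<nu>) n * A n * t ^ n) *
          (hypergeo_coeff (- \<nu>) (\<mu> + of_nat n - \<nu>) (1 + (\<mu> + of_nat n)) k * (\<epsilon> * t) ^ k) = u n k" for k
    proof -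
      have "pochhammer (\<mu> - \<nu>) (n + k) = pochhammer (\<mu> - \<nu>) n * pochhammer (\<mu> + of_nat n - \<nu>) k"
        unfolding pochhammer_product' by (simp add: algebra_simps)
      then show ?thesis
        by (simp add: u_def B_def c_def hypergeo_coeff_def power_add power_mult_distrib add_ac mult_ac)
    qed
    ultimately show "(\<lambda>k. u n k) sums
        (pochhammer (\<mu> - \<nu>) n * A n * t ^ n * legendre_kernel \<nu> (\<mu> + of_nat n) (\<epsilon> * t))" by simp
  next
    have "(\<Sum>n\<le>N. u n (N - n)) = hypergeo_coeff (- \<nu>) (\<mu> - \<nu>) (1 + \<mu>) N * (\<delta> * t) ^ N" for N
    proof -
      have "(\<Sum>n\<le>N. u n (N - n)) = c N * t ^ N * (\<Sum>n\<le>N. A n * B (N - n))"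
        unfolding sum_distrib_left by (intro sum.cong) (auto simp: u_def)
      then show ?thesis unfolding B_def conv
        by (simp add: c_def hypergeo_coeff_def power_mult_distrib)
    qed
    moreover have "norm (\<delta> * t) < 1" using assms by (simp add: norm_mult)
    ultimately show "(\<lambda>N. \<Sum>n\<le>N. u n (N - n)) sums legendre_kernel \<nu> \<mu> (\<delta> * t)"
      using hypergeo_series_sums[of "\<delta> * t"] by (simp add: legendre_kernel_def)
  qed
qed

lemma subexponential_mittag_leffler: "subexponential (\<lambda>n. mittag_leffler n \<sigma>)"
  by (rule subexponential_if_power_series) (rule sums_summable[OF mittag_leffler_sums])

text \<open>
  The rising factorials multiply to \<open>(\<mu> - \<nu>)\<^sub>n\<close>, a common factor that leaves the convolution of the
  coefficients of two reciprocal functions; at \<open>n = 0\<close> this factor is \<open>1\<close>.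
\<close>

lemma scaled_convolution_inverse:
  "(\<Sum>k\<le>n. (pochhammer (\<mu> - \<nu>) k * mittag_leffler k \<sigma>) *
            (pochhammer (\<mu> + of_nat k - \<nu>) (n - k) * mittag_leffler (n - k) (- \<sigma>)))
     = (if n = 0 then 1 else 0)"
proof -
  have "pochhammer (\<mu> - \<nu>) n = pochhammer (\<mu> - \<nu>) k * pochhammer (\<mu> + of_nat k - \<nu>) (n - k)"
    if "k \<le> n" for k
    using pochhammer_product[OF that, of "\<mu> - \<nu>"] by (simp add: algebra_simps)
  then have "(\<Sum>k\<le>n. (pochhammer (\<mu> - \<nu>) k * mittag_leffler k \<sigma>) *
            (pochhammer (\<mu> + of_nat k - \<nu>) (n - k) * mittag_leffler (n - k) (- \<sigma>)))
      = pochhammer (\<mu> - \<nu>) n * (\<Sum>k\<le>n. mittag_leffler k \<sigma> * mittag_leffler (n - k) (- \<sigma>))"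
    unfolding sum_distrib_left by (intro sum.cong) auto
  then show ?thesis unfolding mittag_leffler_convolution_inverse by simp
qed

theorem theorem8:
  fixes x :: real and \<mu> \<nu> :: complex
  assumes "0 < x" and "x < 1"
  shows "((\<lambda>n. pochhammer (\<mu> - \<nu>) n * mittag_leffler n \<nu> *
               complex_of_real (((1 - x) / (1 + x)) powr (real n / 2)) *
               legendre_P \<nu> (- of_nat n - \<mu>) (1 / x))
            sums (legendre_P \<nu> (- \<mu>) x / complex_of_real x powr \<nu>)) \<and>
         ((\<lambda>n. pochhammer (\<mu> - \<nu>) n * mittag_leffler n (- \<nu>) *
               complex_of_real (((1 - x) / (1 + x)) powr (real n / 2)) *
               (legendre_P \<nu> (- of_nat n - \<mu>) x / complex_of_real x powr \<nu>))
            sums legendre_P \<nu> (- \<mu>) (1 / x)) \<and>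
         (\<forall>n. (\<Sum>k\<le>n. (pochhammer (\<mu> - \<nu>) k * mittag_leffler k \<nu>) *
                      (pochhammer (\<mu> + of_nat k - \<nu>) (n - k) * mittag_leffler (n - k) (- \<nu>)))
              = (if n = 0 then 1 else 0)) \<and>
         (\<forall>n. (\<Sum>k\<le>n. (pochhammer (\<mu> - \<nu>) k * mittag_leffler k (- \<nu>)) *
                      (pochhammer (\<mu> + of_nat k - \<nu>) (n - k) * mittag_leffler (n - k) \<nu>))
              = (if n = 0 then 1 else 0))"
proof -
  define t where "t = (1 - x) / (1 + x)"
  have t: "0 < t" "t < 1" using assms by (auto simp: t_def field_simps)
  define K where "K = complex_of_real t powr (\<mu> / 2) * of_real (1 - t) powr (- \<nu>)"
  have order: "- of_nat n - \<mu> = - (\<mu> + of_nat n)" for n by simp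
  \<comment> \<open>Raising \<open>\<mu>\<close> by \<open>n\<close> multiplies the prefactor by \<open>t\<^sup>n\<^sup>/\<^sup>2\<close>; with the explicit factor \<open>t\<^sup>n\<^sup>/\<^sup>2\<close> of the expansion
    this makes the \<open>t\<^sup>n\<close> of the kernel expansion.\<close>
  have prefactor: "a * complex_of_real (t powr (real n / 2)) *
        (of_real t powr ((\<mu> + of_nat n) / 2) * of_real (1 - t) powr (- \<nu>) * k)
      = K * (a * of_real t ^ n * k)" for n a k
  proof -
    have "complex_of_real (t powr (real n / 2)) = of_real t powr (of_nat n / 2)"
      using t by (simp flip: powr_of_real)
    then have "complex_of_real (t powr (real n / 2)) * of_real t powr ((\<mu> + of_nat n) / 2)
        = of_real t powr (\<mu> / 2 + of_nat n)"
      by (simp add: algebra_simps add_divide_distrib flip: powr_add)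
    also have "\<dots> = of_real t powr (\<mu> / 2) * of_real t ^ n"
      using t by (simp add: powr_add powr_nat')
    finally have "(complex_of_real (t powr (real n / 2)) * of_real t powr ((\<mu> + of_nat n) / 2)) *
        (a * of_real (1 - t) powr (- \<nu>) * k)
      = (of_real t powr (\<mu> / 2) * of_real t ^ n) * (a * of_real (1 - t) powr (- \<nu>) * k)" by (simp only:)
    then show ?thesis by (simp only: K_def mult_ac)
  qed
  have 1: "(\<lambda>n. pochhammer (\<mu> - \<nu>) n * mittag_leffler n \<nu> *
               complex_of_real (((1 - x) / (1 + x)) powr (real n / 2)) *
               legendre_P \<nu> (- of_nat n - \<mu>) (1 / x))
            sums (legendre_P \<nu> (- \<mu>) x / complex_of_real x powr \<nu>)"
  proof -
    have "(\<lambda>n. K * (pochhammer (\<mu> - \<nu>) n * mittag_leffler n \<nu> * of_real t ^ n *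
            legendre_kernel \<nu> (\<mu> + of_nat n) (1 * of_real t)))
        sums (K * legendre_kernel \<nu> \<mu> ((- 1) * of_real t))"
      using t mittag_leffler_convolution_binomial[where \<sigma> = \<nu>]
      by (intro sums_mult kernel_expansion subexponential_mittag_leffler) auto
    then show ?thesis
      unfolding order legendre_P_eq_kernel[OF assms] legendre_P_inverse_eq_kernel[OF assms] t_def[symmetric] prefactor
      by (simp add: K_def)
  qed
  have 2: "(\<lambda>n. pochhammer (\<mu> - \<nu>) n * mittag_leffler n (- \<nu>) *
               complex_of_real (((1 - x) / (1 + x)) powr (real n / 2)) *
               (legendre_P \<nu> (- of_nat n - \<mu>) x / complex_of_real x powr \<nu>))
            sums legendre_P \<nu> (- \<mu>) (1 / x)"
  proof -
    have "(\<lambda>n. K * (pochhammer (\<mu> - \<nu>) n * mittag_leffler n (- \<nu>) * of_real t ^ n *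
            legendre_kernel \<nu> (\<mu> + of_nat n) ((- 1) * of_real t)))
        sums (K * legendre_kernel \<nu> \<mu> (1 * of_real t))"
      using t mittag_leffler_convolution_alternating_binomial[where \<sigma> = \<nu>]
      by (intro sums_mult kernel_expansion subexponential_mittag_leffler) auto
    then show ?thesis
      unfolding order legendre_P_eq_kernel[OF assms] legendre_P_inverse_eq_kernel[OF assms] t_def[symmetric] prefactor
      by (simp add: K_def)
  qed
  show ?thesis
    using 1 2 scaled_convolution_inverse[where \<sigma> = \<nu>] scaled_convolution_inverse[where \<sigma> = "- \<nu>"] by simp
qed

end
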